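(* Let $G$ be a given (locally invertible) analytic function and let $y(A)$ be a solution of $$5\int_0^{y(A)}\frac{G(t)}{t\sqrt[6]{t^{-5}-11-t^5}}\,dt=A .$$ Let $w$ be an analytic function and $c$ a constant with $$5\int_0^{y(A)}\frac{dt}{t\sqrt[6]{t^{-5}-11-t^5}}=\frac{c-w(q_A)}{2\pi i},\qquad q_A=e^{2\pi iA},$$ and let $$P(A)=\frac{1}{q_A\,w'(q_A)} .$$ Then $$\bigl(P^{(-1)}\bigr)'(A)=-A\,\frac{d}{dA}\Bigl(F_1^{(-1)}\bigl(G^{(-1)}(-A)\bigr)\Bigr),$$ and $y(A)$ is a solution of the equation $$G(y(A))+P(A)=0 .$$
   Context: $f^{(-1)}$ denotes the (local) inverse function of $f$. $F_1$ denotes the (local) inverse of $x\mapsto 5\int_0^x \frac{dt}{t\sqrt[6]{t^{-5}-11-t^5}}$, so $F_1'(A)=\frac15F_1(A)\sqrt[6]{F_1(A)^{-5}-11-F_1(A)^5}$. All identities are understood on regions where the functions involved are analytic and the functions being inverted are locally invertible, with consistent local branches of inverses and of the sixth root; $w'$ is the derivative of $w$ with respect to its argument $q$. *)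

theory Defs
  imports "HOL-Complex_Analysis.Complex_Analysis"
begin

definition sixth_root_branch :: "complex set \<Rightarrow> (complex \<Rightarrow> complex) \<Rightarrow> bool" where
  "sixth_root_branch D R \<longleftrightarrow>
     R holomorphic_on D \<and> (\<forall>t\<in>D. R t ^ 6 = t powi (-5) - 11 - t ^ 5)"

text \<open>
  The integrands below have a branch point at \<open>0\<close>, so \<open>0\<close> lies on the boundary of the domain \<open>D\<close> on
  which they are holomorphic, and \<open>\<integral>\<^sub>0\<^sup>x\<close> is improper at \<open>0\<close>.  An access path \<open>\<gamma>\<close> enters \<open>D\<close> from \<open>0\<close>;
  the integral from \<open>0\<close> to \<open>x \<in> D\<close> is taken along \<open>\<gamma>\<close> followed by a path inside \<open>D\<close>.
\<close>

definition access_path :: "complex set \<Rightarrow> (real \<Rightarrow> complex) \<Rightarrow> bool" where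
  "access_path D \<gamma> \<longleftrightarrow> valid_path \<gamma> \<and> pathstart \<gamma> = 0 \<and> \<gamma> ` {0<..1} \<subseteq> D"

text \<open>
  The choice of the second path is immaterial for \<open>f\<close> holomorphic on an open simply connected \<open>D\<close>.
  The value is meaningful only if \<open>f\<close> is contour integrable along \<open>\<gamma>\<close>.
\<close>

definition integral_from_0 ::
    "complex set \<Rightarrow> (real \<Rightarrow> complex) \<Rightarrow> (complex \<Rightarrow> complex) \<Rightarrow> complex \<Rightarrow> complex" where
  "integral_from_0 D \<gamma> f x =
     contour_integral
       (\<gamma> +++ (SOME g. valid_path g \<and> path_image g \<subseteq> D \<and>
                       pathstart g = pathfinish \<gamma> \<and> pathfinish g = x)) f"

text \<open>
  \<open>g\<close> is a local inverse of \<open>f\<close>, namely the branch that takes \<open>f z\<close> back to \<open>z\<close>.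
  (Both conditions include the base points themselves.)
\<close>

definition local_inverse_at ::
    "(complex \<Rightarrow> complex) \<Rightarrow> complex \<Rightarrow> (complex \<Rightarrow> complex) \<Rightarrow> bool" where
  "local_inverse_at f z g \<longleftrightarrow>
     (\<forall>\<^sub>F x in nhds z. g (f x) = x) \<and> (\<forall>\<^sub>F u in nhds (f z). f (g u) = u)"

definition q_of :: "complex \<Rightarrow> complex" where
  "q_of A = exp (2 * pi * \<i> * A)"

definition P_of :: "(complex \<Rightarrow> complex) \<Rightarrow> complex \<Rightarrow> complex" where
  "P_of w A = 1 / (q_of A * deriv w (q_of A))"

end

theory Submission
  imports Defs
begin

text \<open>
  Both integrals are primitives on \<open>D\<close>, so differentiating the two hypotheses on \<open>y\<close> gives, with
  \<open>h(t) = 5 / (t R(t))\<close>, the relations \<open>G(y) h(y) y' = 1\<close> and \<open>h(y) y' = - q w'(q)\<close>, whence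
  \<open>G(y) = - P\<close>.  Consequently \<open>G\<^sup>-\<^sup>1(-a) = y(P\<^sup>-\<^sup>1(a))\<close>, and since the inverse of \<open>F\<^sub>1\<close> is the integral
  \<open>\<Phi>\<close> of \<open>h\<close>, the function \<open>F\<^sub>1\<^sup>-\<^sup>1(G\<^sup>-\<^sup>1(-a))\<close> is \<open>\<Phi> \<circ> y \<circ> P\<^sup>-\<^sup>1\<close>, with derivative
  \<open>(P\<^sup>-\<^sup>1)'(a) / G(y) = - (P\<^sup>-\<^sup>1)'(a) / a\<close>.
\<close>

text \<open>
  A zero of \<open>R\<close> would be a zero of order at least six of \<open>t\<^sup>-\<^sup>5 - 11 - t\<^sup>5\<close>, whose zeros are simple.
\<close>

lemma sixth_root_branch_nonzero:
  assumes "sixth_root_branch D R" "open D" "0 \<notin> D" "t \<in> D"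
  shows "R t \<noteq> 0"
proof
  assume Rt: "R t = 0"
  \<comment> \<open>Multiplying by \<open>t ^ 5\<close> clears the pole and turns the radicand into
    a polynomial, quadratic in \<open>t ^ 5\<close>.\<close>
  define p where "p = (\<lambda>t::complex. 1 - 11 * t ^ 5 - t ^ 10)"
  have hol: "R holomorphic_on D" and R6: "\<And>t. t \<in> D \<Longrightarrow> R t ^ 6 = t powi (-5) - 11 - t ^ 5"
    using assms(1) by (auto simp: sixth_root_branch_def)
  have p: "s ^ 5 * R s ^ 6 = p s" if "s \<in> D" for s
  proof -
    have "s \<noteq> 0" using that assms(3) by auto
    have "s ^ 5 * R s ^ 6 = s ^ 5 * inverse (s ^ 5) - 11 * s ^ 5 - s ^ 5 * s ^ 5"
      unfolding R6[OF that] by (simp add: power_int_minus algebra_simps)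
    also have "\<dots> = p s"
      using \<open>s \<noteq> 0\<close> by (simp add: p_def flip: power_add)
    finally show ?thesis .
  qed
  have "(R has_field_derivative deriv R t) (at t)"
    using hol assms(2,4) by (simp add: holomorphic_derivI)
  \<comment> \<open>Every term of the product rule keeps a factor \<open>R t\<close>, which
    vanishes.\<close>
  then have "((\<lambda>s. s ^ 5 * R s ^ 6) has_field_derivative 0) (at t)"
    by (auto intro!: derivative_eq_intros simp: Rt)
  then have "(p has_field_derivative 0) (at t)"
    by (rule has_field_derivative_transform_within_open) (use assms p in auto)
  moreover have "(p has_field_derivative (- 55 * t ^ 4 - 10 * t ^ 9)) (at t)"
    unfolding p_def by (auto intro!: derivative_eq_intros)
  ultimately have "- 55 * t ^ 4 - 10 * t ^ 9 = 0"
    using DERIV_unique by blast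
  then have "t ^ 4 * (11 + 2 * t ^ 5) = 0"
    by algebra
  moreover have "t \<noteq> 0" using assms by auto
  ultimately have "2 * t ^ 5 = - 11"
    by (simp add: add_eq_0_iff)
  moreover have "1 - 11 * t ^ 5 - t ^ 10 = 0"
    using p[OF assms(4)] Rt by (simp add: p_def)
  moreover have "t ^ 10 = (t ^ 5)\<^sup>2"
    by simp
  \<comment> \<open>125 is the discriminant of \<open>1 - 11 * u - u ^ 2\<close>: at
    \<open>u = t ^ 5 = - 11 / 2\<close> this quadratic takes the value 125/4.\<close>
  ultimately have "(125::complex) = 0"
    by algebra
  then show False by simp
qed

text \<open>As \<open>D\<close> is simply connected, \<open>f\<close> has a primitive
  \<open>H\<close> there, so the stretch inside \<open>D\<close> contributes
  \<open>H z - H (pathfinish \<gamma>)\<close> whichever path \<open>SOME\<close> picks; one exists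
  because \<open>D\<close> is open and connected. The stretch along \<open>\<gamma>\<close> does not
  depend on \<open>z\<close>, so the whole integral differs from \<open>H\<close> by a
  constant.\<close>

lemma integral_from_0_has_field_derivative:
  assumes D: "open D" "simply_connected D"
    and \<gamma>: "access_path D \<gamma>" and f: "f holomorphic_on D" "f contour_integrable_on \<gamma>"
    and x: "x \<in> D"
  shows "(integral_from_0 D \<gamma> f has_field_derivative f x) (at x)"
proof -
  obtain H where H: "\<And>z. z \<in> D \<Longrightarrow> (H has_field_derivative f z) (at z)"
    using simply_connected_eq_global_primitive[OF D(1)] D(2) f(1) by metis
  have \<gamma>1: "pathfinish \<gamma> \<in> D" and v\<gamma>: "valid_path \<gamma>"
    using \<gamma> by (auto simp: access_path_def pathfinish_def image_subset_iff)
  have conn: "connected D"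
    using D(2) simply_connected_imp_connected by blast
  have eq: "contour_integral \<gamma> f + (H z - H (pathfinish \<gamma>)) = integral_from_0 D \<gamma> f z"
    if z: "z \<in> D" for z
  proof -
    define g where "g = (SOME g. valid_path g \<and> path_image g \<subseteq> D \<and>
                       pathstart g = pathfinish \<gamma> \<and> pathfinish g = z)"
    have "\<exists>g. valid_path g \<and> path_image g \<subseteq> D \<and> pathstart g = pathfinish \<gamma> \<and> pathfinish g = z"
      using connected_open_polynomial_connected[OF D(1) conn \<gamma>1 z] valid_path_polynomial_function
      by blast
    from someI_ex[OF this]
    have g: "valid_path g" "path_image g \<subseteq> D" "pathstart g = pathfinish \<gamma>" "pathfinish g = z"
      unfolding g_def by blast+
    have int: "(f has_contour_integral (H z - H (pathfinish \<gamma>))) g"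
      using contour_integral_primitive[OF _ g(1,2), of H f] H g(3,4)
      by (metis has_field_derivative_at_within)
    have "integral_from_0 D \<gamma> f z = contour_integral (\<gamma> +++ g) f"
      by (simp add: integral_from_0_def g_def)
    also have "\<dots> = contour_integral \<gamma> f + contour_integral g f"
      using f(2) int v\<gamma> g by (intro contour_integral_join) (auto simp: contour_integrable_on_def)
    finally show ?thesis
      using contour_integral_unique[OF int] by simp
  qed
  have "((\<lambda>z. contour_integral \<gamma> f + (H z - H (pathfinish \<gamma>))) has_field_derivative f x) (at x)"
    using H[OF x] by (auto intro!: derivative_eq_intros)
  then show ?thesis
    by (rule has_field_derivative_transform_within_open[OF _ D(1) x eq])
qed

text \<open>A local inverse is only assumed to invert pointwise. Having a left inverse makes
  \<open>f\<close> injective on \<open>V\<close>, hence open with a holomorphic inverse, and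
  \<open>g\<close> must agree with that inverse on the image. This yields the differentiability of
  \<open>P_inv\<close>.\<close>

lemma holomorphic_on_left_inverse:
  assumes f: "f holomorphic_on V" "open V" and inv: "\<And>x. x \<in> V \<Longrightarrow> g (f x) = x"
  shows "open (f ` V)" "g holomorphic_on f ` V"
proof -
  have inj: "inj_on f V"
    using inv by (rule inj_on_inverseI)
  then show "open (f ` V)"
    using open_mapping_thm3 f by blast
  obtain k where k: "k holomorphic_on f ` V" "\<And>z. z \<in> V \<Longrightarrow> k (f z) = z"
    using holomorphic_has_inverse[OF f inj] by metis
  show "g holomorphic_on f ` V"
    using k(1) by (rule holomorphic_transform) (auto simp: k(2) inv)
qed

theorem theorem4:
  fixes G R y w :: "complex \<Rightarrow> complex" and c :: complex
    and D U W :: "complex set" and \<gamma> :: "real \<Rightarrow> complex"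
  defines "\<Phi> \<equiv> (\<lambda>x. 5 * integral_from_0 D \<gamma> (\<lambda>t. 1 / (t * R t)) x)"
  assumes D: "open D" "simply_connected D" "0 \<notin> D"
    and R: "sixth_root_branch D R"
    and \<gamma>: "access_path D \<gamma>"
    and G: "G holomorphic_on D"
    and integrable: "(\<lambda>t. G t / (t * R t)) contour_integrable_on \<gamma>"
                    "(\<lambda>t. 1 / (t * R t)) contour_integrable_on \<gamma>"
    and U: "open U"
    and y: "y holomorphic_on U" "y ` U \<subseteq> D"
    and G_loc_inv: "\<forall>A\<in>U. \<exists>g. local_inverse_at G (y A) g"
    and y_eq: "\<forall>A\<in>U. 5 * integral_from_0 D \<gamma> (\<lambda>t. G t / (t * R t)) (y A) = A"
    and w: "open W" "w holomorphic_on W" "q_of ` U \<subseteq> W"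
    and w_eq: "\<forall>A\<in>U. 5 * integral_from_0 D \<gamma> (\<lambda>t. 1 / (t * R t)) (y A)
                        = (c - w (q_of A)) / (2 * pi * \<i>)"
  shows "(\<forall>A\<^sub>0\<in>U. \<forall>P_inv G_inv F\<^sub>1 F\<^sub>1_inv.
            local_inverse_at (P_of w) A\<^sub>0 P_inv \<longrightarrow>
            local_inverse_at G (y A\<^sub>0) G_inv \<longrightarrow>
            local_inverse_at \<Phi> (y A\<^sub>0) F\<^sub>1 \<longrightarrow>
            local_inverse_at F\<^sub>1 (\<Phi> (y A\<^sub>0)) F\<^sub>1_inv \<longrightarrow>
            (\<forall>\<^sub>F A in nhds (P_of w A\<^sub>0).
               deriv P_inv A = - A * deriv (\<lambda>a. F\<^sub>1_inv (G_inv (- a))) A))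
       \<and> (\<forall>A\<in>U. G (y A) + P_of w A = 0)"
proof (intro conjI ballI allI impI)
  have qw: "(w \<circ> q_of has_field_derivative 2 * pi * \<i> * (q_of A * deriv w (q_of A))) (at A)"
    if "A \<in> U" for A
  proof -
    have "(w has_field_derivative deriv w (q_of A)) (at (q_of A))"
      using w that by (auto intro!: holomorphic_derivI)
    moreover have "(q_of has_field_derivative 2 * pi * \<i> * q_of A) (at A)"
      unfolding q_of_def[abs_def] by (auto intro!: derivative_eq_intros)
    ultimately show ?thesis
      by (auto dest: DERIV_chain simp: mult_ac)
  qed
  have hol: "(\<lambda>t. 1 / (t * R t)) holomorphic_on D"
    using R D sixth_root_branch_nonzero[OF R D(1,3)]
    by (auto intro!: holomorphic_intros simp: sixth_root_branch_def)
  then have hol_G: "(\<lambda>t. G t / (t * R t)) holomorphic_on D"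
    using holomorphic_on_mult[OF G hol] by simp
  have \<Phi>: "(\<Phi> has_field_derivative 5 * (1 / (x * R x))) (at x)" if "x \<in> D" for x
    unfolding \<Phi>_def
    by (rule DERIV_cmult[OF integral_from_0_has_field_derivative[OF D(1,2) \<gamma> hol integrable(2) that]])
  \<comment> \<open>Differentiating \<open>y_eq\<close> gives the first relation and
    \<open>w_eq\<close> the third, where the factor \<open>2 * pi * \<i>\<close> from the derivative
    of \<open>q_of\<close> cancels the denominator.\<close>
  have key: "G (y A) * deriv (\<Phi> \<circ> y) A = 1" "((\<Phi> \<circ> y) has_field_derivative deriv (\<Phi> \<circ> y) A) (at A)"
            "deriv (\<Phi> \<circ> y) A = - (q_of A * deriv w (q_of A))"
    if A: "A \<in> U" for A
  proof -
    have yA: "y A \<in> D" using y A by auto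
    have y': "(y has_field_derivative deriv y A) (at A)"
      using y U A by (auto intro!: holomorphic_derivI)
    have 1: "((\<Phi> \<circ> y) has_field_derivative 5 * (1 / (y A * R (y A))) * deriv y A) (at A)"
      by (rule DERIV_chain[OF \<Phi>[OF yA] y'])
    then have d: "deriv (\<Phi> \<circ> y) A = 5 * (1 / (y A * R (y A))) * deriv y A"
      by (rule DERIV_imp_deriv)
    show "((\<Phi> \<circ> y) has_field_derivative deriv (\<Phi> \<circ> y) A) (at A)"
      using 1 d by simp
    have "((\<lambda>A. 5 * integral_from_0 D \<gamma> (\<lambda>t. G t / (t * R t)) (y A)) has_field_derivative
            5 * (G (y A) / (y A * R (y A)) * deriv y A)) (at A)"
      by (rule DERIV_cmult[OF DERIV_chain2[OF
            integral_from_0_has_field_derivative[OF D(1,2) \<gamma> hol_G integrable(1) yA] y']])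
    then have "((\<lambda>A. A) has_field_derivative 5 * (G (y A) / (y A * R (y A)) * deriv y A)) (at A)"
      by (rule has_field_derivative_transform_within_open[OF _ U A]) (use y_eq in auto)
    then have "5 * (G (y A) / (y A * R (y A)) * deriv y A) = 1"
      using DERIV_unique DERIV_ident by blast
    then show "G (y A) * deriv (\<Phi> \<circ> y) A = 1"
      by (simp add: d mult_ac)
    have "((\<lambda>A. (c - (w \<circ> q_of) A) / (2 * pi * \<i>)) has_field_derivative
            (0 - 2 * pi * \<i> * (q_of A * deriv w (q_of A))) / (2 * pi * \<i>)) (at A)"
      by (rule DERIV_cdivide[OF DERIV_diff[OF DERIV_const qw[OF A]]])
    then have "((\<Phi> \<circ> y) has_field_derivative
            (0 - 2 * pi * \<i> * (q_of A * deriv w (q_of A))) / (2 * pi * \<i>)) (at A)"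
      by (rule has_field_derivative_transform_within_open[OF _ U A]) (use w_eq in \<open>auto simp: \<Phi>_def\<close>)
    then show "deriv (\<Phi> \<circ> y) A = - (q_of A * deriv w (q_of A))"
      by (auto dest!: DERIV_imp_deriv)
  qed
  have GP: "G (y A) + P_of w A = 0" if A: "A \<in> U" for A
  proof -
    have "G (y A) * (q_of A * deriv w (q_of A)) = -1"
      using key(1)[OF A] unfolding key(3)[OF A] by (simp add: minus_equation_iff)
    \<comment> \<open>A product equal to -1 has no zero factor, so the quotient in
      \<open>P_of\<close> is a genuine one and not the default value 0.\<close>
    moreover from this have "q_of A * deriv w (q_of A) \<noteq> 0"
      by force
    ultimately show ?thesis
      by (simp add: P_of_def field_simps)
  qed
  then show "G (y A) + P_of w A = 0" if "A \<in> U" for A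
    using that .
  fix A\<^sub>0 P_inv G_inv F\<^sub>1 F\<^sub>1_inv
  assume A0: "A\<^sub>0 \<in> U" and P_inv: "local_inverse_at (P_of w) A\<^sub>0 P_inv"
    and G_inv: "local_inverse_at G (y A\<^sub>0) G_inv"
    and F1: "local_inverse_at \<Phi> (y A\<^sub>0) F\<^sub>1"
    and F1_inv: "local_inverse_at F\<^sub>1 (\<Phi> (y A\<^sub>0)) F\<^sub>1_inv"
  \<comment> \<open>Continuity pulls the inverse identities, valid near \<open>y A\<^sub>0\<close>
    and near \<open>\<Phi> (y A\<^sub>0)\<close>, back to a neighbourhood of
    \<open>A\<^sub>0\<close>.\<close>
  have lim_y: "filterlim y (nhds (y A\<^sub>0)) (nhds A\<^sub>0)"
    using holomorphic_on_imp_continuous_on[OF y(1)] U A0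
    by (metis continuous_on_eq_continuous_at isCont_def tendsto_at_iff_tendsto_nhds)
  have lim_\<Phi>y: "filterlim (\<Phi> \<circ> y) (nhds (\<Phi> (y A\<^sub>0))) (nhds A\<^sub>0)"
    using DERIV_isCont[OF key(2)[OF A0]]
    by (metis comp_apply isCont_def tendsto_at_iff_tendsto_nhds)
  have "\<forall>\<^sub>F A in nhds A\<^sub>0. G_inv (G (y A)) = y A"
    using G_inv by (intro eventually_compose_filterlim[OF _ lim_y]) (simp add: local_inverse_at_def)
  \<comment> \<open>Inverting twice returns \<open>\<Phi>\<close>: apply
    \<open>F\<^sub>1_inv\<close> to \<open>F\<^sub>1 (\<Phi> (y A)) = y A\<close>.\<close>
  moreover have "\<forall>\<^sub>F A in nhds A\<^sub>0. F\<^sub>1_inv (y A) = \<Phi> (y A)"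
  proof -
    have "\<forall>\<^sub>F A in nhds A\<^sub>0. F\<^sub>1 (\<Phi> (y A)) = y A"
      using F1 by (intro eventually_compose_filterlim[OF _ lim_y]) (simp add: local_inverse_at_def)
    moreover have "\<forall>\<^sub>F A in nhds A\<^sub>0. F\<^sub>1_inv (F\<^sub>1 ((\<Phi> \<circ> y) A)) = (\<Phi> \<circ> y) A"
      using F1_inv by (intro eventually_compose_filterlim[OF _ lim_\<Phi>y]) (simp add: local_inverse_at_def)
    ultimately show ?thesis
      by eventually_elim simp
  qed
  moreover have "\<forall>\<^sub>F A in nhds A\<^sub>0. A \<in> U"
    using U A0 by (rule eventually_nhds_in_open)
  moreover have "\<forall>\<^sub>F A in nhds A\<^sub>0. P_inv (P_of w A) = A"
    using P_inv by (simp add: local_inverse_at_def)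
  ultimately have "\<forall>\<^sub>F A in nhds A\<^sub>0. A \<in> U \<and> P_inv (P_of w A) = A \<and>
                     F\<^sub>1_inv (G_inv (- P_of w A)) = (\<Phi> \<circ> y) A"
    by eventually_elim (use GP in \<open>auto simp: add_eq_0_iff\<close>)
  then obtain V where V: "open V" "A\<^sub>0 \<in> V" "V \<subseteq> U"
    and P_inv_V: "\<And>A. A \<in> V \<Longrightarrow> P_inv (P_of w A) = A"
    and comp: "\<And>A. A \<in> V \<Longrightarrow> (\<Phi> \<circ> y) A = F\<^sub>1_inv (G_inv (- P_of w A))"
    unfolding eventually_nhds by (metis subsetI)
  \<comment> \<open>Holomorphy of \<open>P_of w\<close> is read off from its equality with
    \<open>- (G \<circ> y)\<close>, which avoids the quotient and the derivative of
    \<open>w\<close>.\<close>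
  have "(\<lambda>A. - (G \<circ> y) A) holomorphic_on V"
    using holomorphic_on_compose_gen[OF y(1) G y(2)] V(3)
    by (intro holomorphic_on_minus) (rule holomorphic_on_subset)
  then have "P_of w holomorphic_on V"
    by (rule holomorphic_transform) (use GP V(3) in \<open>auto simp: add_eq_0_iff\<close>)
  from holomorphic_on_left_inverse[OF this V(1) P_inv_V]
  have PV: "open (P_of w ` V)" and P_inv_hol: "P_inv holomorphic_on P_of w ` V"
    by blast+
  have main: "deriv P_inv a = - a * deriv (\<lambda>a. F\<^sub>1_inv (G_inv (- a))) a"
    if a: "a \<in> P_of w ` V" for a
  proof -
    obtain A where A: "A \<in> V" "a = P_of w A"
      using a by blast
    then have AU: "A \<in> U" and PA: "P_inv a = A"
      using V P_inv_V by auto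
    have "((\<Phi> \<circ> y) \<circ> P_inv has_field_derivative deriv (\<Phi> \<circ> y) A * deriv P_inv a) (at a)"
      using key(2)[OF AU] holomorphic_derivI[OF P_inv_hol PV a] unfolding PA[symmetric]
      by (rule DERIV_chain)
    then have "((\<lambda>a. F\<^sub>1_inv (G_inv (- a))) has_field_derivative
                 deriv (\<Phi> \<circ> y) A * deriv P_inv a) (at a)"
      by (rule has_field_derivative_transform_within_open[OF _ PV a])
         (use P_inv_V comp in auto)
    then have "- a * deriv (\<lambda>a. F\<^sub>1_inv (G_inv (- a))) a
                 = (- a * deriv (\<Phi> \<circ> y) A) * deriv P_inv a"
      by (simp add: DERIV_imp_deriv)
    \<comment> \<open>Here \<open>- a = G (y A)\<close>, so this is the first relation of
      \<open>key\<close>.\<close>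
    moreover have "- a * deriv (\<Phi> \<circ> y) A = 1"
      using GP[OF AU] key(1)[OF AU] A(2) by (simp add: eq_neg_iff_add_eq_0 [symmetric])
    ultimately show ?thesis
      by (metis mult_1)
  qed
  show "\<forall>\<^sub>F A in nhds (P_of w A\<^sub>0). deriv P_inv A = - A * deriv (\<lambda>a. F\<^sub>1_inv (G_inv (- a))) A"
    by (rule eventually_mono[OF eventually_nhds_in_open[OF PV imageI[OF V(2)]] main])
qed

end
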